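(* Suppose that $\boldsymbol\Sigma_{kk}\neq 0$ for all $k=1,\dots,p$. Let $s_1>0$ and $s_2>0$ with $s_1\neq s_2$. Then, as $n\to\infty$, $$\hat\alpha_s(k)\xrightarrow{a.s.}\alpha\quad (k=1,\dots,p),\qquad \hat\alpha^{mult}\xrightarrow{a.s.}\alpha .$$
   Context: Let $p\ge 1$, $0<\alpha<2$, $\boldsymbol\mu\in\mathbb{R}^p$, and let $\boldsymbol\Sigma$ be a real symmetric positive semi-definite $p\times p$ matrix. The $p$-dimensional sub-Gaussian stable distribution $S_p(\boldsymbol\mu,\boldsymbol\Sigma,\alpha)$ is the law on $\mathbb{R}^p$ with characteristic function $$\phi(\mathbf{t})=\mathbb{E}[e^{i\mathbf{t}^\top\mathbf{x}}]=\exp\Big(i\mathbf{t}^\top\boldsymbol\mu-\big(\tfrac12\mathbf{t}^\top\boldsymbol\Sigma\mathbf{t}\big)^{\alpha/2}\Big),\quad \mathbf{t}\in\mathbb{R}^p.$$ Let $\mathbf{x}_1,\mathbf{x}_2,\dots$ be i.i.d. with law $S_p(\boldsymbol\mu,\boldsymbol\Sigma,\alpha)$. The empirical characteristic function is $\hat\phi_n(\mathbf{t})=\frac1n\sum_{j=1}^n e^{i\mathbf{t}^\top\mathbf{x}_j}$. Let $\mathbf{e}_k\in\mathbb{R}^p$ be the $k$-th standard basis vector. Define $$\hat\alpha_s(k):=\frac{1}{\log|s_1/s_2|}\log\left[\frac{\log|\hat\phi_n(s_1\mathbf{e}_k)|}{\log|\hat\phi_n(s_2\mathbf{e}_k)|}\right],\qquad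 \hat\alpha^{mult}:=\frac1p\sum_{k=1}^p\hat\alpha_s(k).$$ Both depend on the sample size $n$. *)

theory Defs
  imports "HOL-Probability.Probability"
begin

text \<open>
  \<open>N\<close> is the law \<open>S\<^sub>p(\<mu>, \<Sigma>, \<alpha>)\<close> on \<open>\<real>\<^sup>p\<close> (\<open>p = CARD('p)\<close>), given by its characteristic function.
  A predicate on measures is used because the law is specified through its characteristic
  function only, without a construction.
\<close>

definition sub_Gaussian_stable ::
  "real ^ 'p \<Rightarrow> real ^ 'p ^ 'p \<Rightarrow> real \<Rightarrow> (real ^ 'p) measure \<Rightarrow> bool" where
  "sub_Gaussian_stable \<mu> \<Sigma> \<alpha> N \<longleftrightarrow>
     prob_space N \<and> sets N = sets borel \<and>
     (\<forall>t. (CLINT x|N. iexp (t \<bullet> x)) =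
          exp (\<i> * complex_of_real (t \<bullet> \<mu>)
               - complex_of_real (((1/2) * (t \<bullet> (\<Sigma> *v t))) powr (\<alpha> / 2))))"

text \<open>
  \<open>x\<close> is a realised sample sequence, indexed from 0, so the sample of size \<open>n\<close> is
  \<open>x 0, \<dots>, x (n - 1)\<close>.
\<close>

definition ecf :: "(nat \<Rightarrow> real ^ 'p) \<Rightarrow> nat \<Rightarrow> real ^ 'p \<Rightarrow> complex" where
  "ecf x n t = (1 / of_nat n) * (\<Sum>j<n. iexp (t \<bullet> x j))"

text \<open>
  Where the estimator is not defined mathematically (\<open>n = 0\<close>, or an empirical characteristic
  function of modulus 0 or 1), it takes the value given by \<open>ln 0 = 0\<close> and \<open>x / 0 = 0\<close>.
\<close>

definition alpha_hat ::
  "(nat \<Rightarrow> real ^ 'p) \<Rightarrow> real \<Rightarrow> real \<Rightarrow> nat \<Rightarrow> 'p \<Rightarrow> real" where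
  "alpha_hat x s1 s2 n k =
     1 / ln \<bar>s1 / s2\<bar> *
     ln (ln (cmod (ecf x n (s1 *\<^sub>R axis k 1))) / ln (cmod (ecf x n (s2 *\<^sub>R axis k 1))))"

definition alpha_hat_mult ::
  "(nat \<Rightarrow> real ^ 'p) \<Rightarrow> real \<Rightarrow> real \<Rightarrow> nat \<Rightarrow> real" where
  "alpha_hat_mult x s1 s2 n = 1 / real CARD('p) * (\<Sum>k\<in>UNIV. alpha_hat x s1 s2 n k)"

end

theory Submission
  imports Defs
begin

text \<open>
  Both claims reduce to one almost sure limit. For a fixed \<open>t\<close>, the empirical characteristic
  function at \<open>t\<close> is an average of i.i.d. complex random variables of modulus 1, so by the strong
  law of large numbers it converges almost surely to \<open>\<phi>(t)\<close>. At \<open>t = s e\<^sub>k\<close> the location \<open>\<mu>\<close> only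
  contributes a phase, hence \<open>log |\<phi>(s e\<^sub>k)| = - (s\<^sup>2 \<Sigma>\<^sub>k\<^sub>k / 2)\<^bsup>\<alpha>/2\<^esup>\<close>, which is nonzero because
  \<open>\<Sigma>\<^sub>k\<^sub>k > 0\<close>. In the quotient of these logarithms at \<open>s\<^sub>1\<close> and \<open>s\<^sub>2\<close> the unknown scale \<open>\<Sigma>\<^sub>k\<^sub>k\<close> cancels
  and \<open>(s\<^sub>1/s\<^sub>2)\<^bsup>\<alpha>\<^esup>\<close> remains; its logarithm divided by \<open>log (s\<^sub>1/s\<^sub>2)\<close> is \<open>\<alpha>\<close>, and all these operations
  are continuous at the limit. Averaging over the finitely many coordinates gives the second claim.

  The strong law is needed only for bounded variables. There Hoeffding's inequality makes the
  probability of a deviation by \<open>\<epsilon>\<close> of the average of \<open>n\<close> variables decay geometrically in \<open>n\<close>,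
  so the Borel--Cantelli lemma applies directly.
\<close>

text \<open>
  For each \<open>\<epsilon>\<close> the Hoeffding bounds are summable in \<open>n\<close>, so by Borel--Cantelli almost surely only
  finitely many averages deviate by \<open>\<epsilon>\<close> or more. Letting \<open>\<epsilon>\<close> run through \<open>1/(i+1)\<close> keeps the
  exceptional set a countable union of null sets.
\<close>

lemma (in prob_space) strong_law_bounded:
  fixes Y :: "nat \<Rightarrow> 'a \<Rightarrow> real"
  assumes indep: "indep_vars (\<lambda>_. borel) Y UNIV"
    and bounded: "\<And>j. AE \<omega> in M. \<bar>Y j \<omega>\<bar> \<le> c"
    and mean: "\<And>j. expectation (Y j) = m"
  shows "AE \<omega> in M. (\<lambda>n. (\<Sum>j<n. Y j \<omega>) / real n) \<longlonglongrightarrow> m"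
proof -
  (* Hoeffding's inequality needs an interval of positive length, also when c = 0. *)
  define b where "b = \<bar>c\<bar> + 1"
  have b: "b > 0" by (simp add: b_def)
  have [measurable]: "random_variable borel (Y j)" for j
    using indep by (auto simp: indep_vars_def)
  define A where "A \<epsilon> n = {\<omega>\<in>space M. \<epsilon> \<le> \<bar>(\<Sum>j<n. Y j \<omega>) / real n - m\<bar>}" for \<epsilon> n
  have [measurable]: "A \<epsilon> n \<in> events" for \<epsilon> n
    unfolding A_def by measurable
  have prob_A: "prob (A \<epsilon> n) \<le> 2 * exp (- \<epsilon>\<^sup>2 / (2 * b\<^sup>2)) ^ n" if "\<epsilon> > 0" "n > 0" for \<epsilon> n
  proof -
    interpret H: Hoeffding_ineq M "{..<n}" Y "\<lambda>_. - b" "\<lambda>_. b" "real n * m"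
    proof unfold_locales
      show "indep_vars (\<lambda>_. borel) Y {..<n}"
        by (rule indep_vars_subset[OF indep]) simp
      show "AE \<omega> in M. Y j \<omega> \<in> {- b..b}" for j
        using bounded[of j] by eventually_elim (auto simp: b_def)
      show "real n * m \<equiv> \<Sum>j<n. expectation (Y j)"
        by (simp add: mean)
    qed simp
    have "A \<epsilon> n = {\<omega>\<in>space M. real n * \<epsilon> \<le> \<bar>(\<Sum>j<n. Y j \<omega>) - real n * m\<bar>}"
    proof -
      have "\<bar>S - real n * m\<bar> = real n * \<bar>S / real n - m\<bar>" for S
      proof -
        have "S - real n * m = real n * (S / real n - m)"
          using \<open>n > 0\<close> by (simp add: right_diff_distrib)
        then show ?thesis by (simp only: abs_mult abs_of_nat)
      qed
      then show ?thesis
        using \<open>n > 0\<close> by (simp add: A_def)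
    qed
    also have "prob \<dots> \<le> 2 * exp (-2 * (real n * \<epsilon>)\<^sup>2 / (\<Sum>j<n. (b - - b)\<^sup>2))"
      using b that by (intro H.Hoeffding_ineq_abs_ge) auto
    also have "-2 * (real n * \<epsilon>)\<^sup>2 / (\<Sum>j<n. (b - - b)\<^sup>2) = real n * (- \<epsilon>\<^sup>2 / (2 * b\<^sup>2))"
      using b that by (simp add: field_simps power2_eq_square)
    finally show ?thesis
      by (simp only: exp_of_nat_mult)
  qed
  have "AE \<omega> in M. \<forall>\<^sub>F n in sequentially. \<omega> \<in> space M - A \<epsilon> n" if "\<epsilon> > 0" for \<epsilon>
  proof (rule borel_cantelli_AE1)
    have "summable (\<lambda>n. 2 * exp (- \<epsilon>\<^sup>2 / (2 * b\<^sup>2)) ^ n)"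
      using b that by (intro summable_mult summable_geometric) simp
    then show "summable (\<lambda>n. prob (A \<epsilon> n))"
      by (rule summable_comparison_test'[where N = 1]) (use prob_A that in auto)
  qed (simp_all add: emeasure_eq_measure)
  then have "AE \<omega> in M. \<forall>i. \<forall>\<^sub>F n in sequentially. \<omega> \<in> space M - A (1 / real (Suc i)) n"
    by (subst AE_all_countable) simp
  then show ?thesis
  proof eventually_elim
    case (elim \<omega>)
    show ?case
    proof (rule tendstoI)
      fix e :: real assume "e > 0"
      then obtain i where i: "1 / real (Suc i) < e"
        using reals_Archimedean by (auto simp: inverse_eq_divide)
      show "\<forall>\<^sub>F n in sequentially. dist ((\<Sum>j<n. Y j \<omega>) / real n) m < e"
        using elim[rule_format, of i]
        by eventually_elim (use i in \<open>auto simp: A_def dist_real_def\<close>)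
    qed
  qed
qed

lemma (in prob_space) strong_law_bounded_complex:
  fixes X :: "nat \<Rightarrow> 'a \<Rightarrow> 'b::topological_space" and f :: "'b \<Rightarrow> complex"
  assumes indep: "indep_vars (\<lambda>_. borel) X UNIV"
    and ident: "\<And>j. distr M borel (X j) = N"
    and f [measurable]: "f \<in> borel_measurable borel"
    and bounded: "\<And>x. cmod (f x) \<le> c"
  shows "AE \<omega> in M. (\<lambda>n. (1 / of_nat n) * (\<Sum>j<n. f (X j \<omega>))) \<longlonglongrightarrow> (CLINT x|N. f x)"
proof -
  have [measurable]: "random_variable borel (X j)" for j
    using indep by (auto simp: indep_vars_def)
  have sets_N [measurable_cong]: "sets N = sets borel"
    using ident[of 0] by auto
  interpret N: prob_space N
    using ident[of 0] by (auto intro: prob_space_distr)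
  have int_f: "integrable N f"
    by (rule N.integrable_const_bound[where B = c]) (use bounded in auto)
  have law: "AE \<omega> in M. (\<lambda>n. (\<Sum>j<n. g (X j \<omega>)) / real n) \<longlonglongrightarrow> (\<integral>x. g x \<partial>N)"
    if [measurable]: "g \<in> borel_measurable borel" and "\<And>x. \<bar>g x\<bar> \<le> cmod (f x)" for g
  proof (rule strong_law_bounded)
    show "indep_vars (\<lambda>_. borel) (\<lambda>j \<omega>. g (X j \<omega>)) UNIV"
      by (rule indep_vars_compose2[OF indep]) simp
    show "AE \<omega> in M. \<bar>g (X j \<omega>)\<bar> \<le> c" for j
      using that(2) bounded order_trans by blast
    show "expectation (\<lambda>\<omega>. g (X j \<omega>)) = (\<integral>x. g x \<partial>N)" for j
      by (subst ident[of j, symmetric], subst integral_distr) simp_all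
  qed
  have "AE \<omega> in M. (\<lambda>n. (\<Sum>j<n. Re (f (X j \<omega>))) / real n) \<longlonglongrightarrow> (\<integral>x. Re (f x) \<partial>N)"
    by (rule law) (simp_all add: abs_Re_le_cmod)
  moreover have "AE \<omega> in M. (\<lambda>n. (\<Sum>j<n. Im (f (X j \<omega>))) / real n) \<longlonglongrightarrow> (\<integral>x. Im (f x) \<partial>N)"
    by (rule law) (simp_all add: abs_Im_le_cmod)
  ultimately show ?thesis
  proof eventually_elim
    case (elim \<omega>)
    then show ?case
      using int_f by (simp add: tendsto_complex_iff Re_divide_of_nat Im_divide_of_nat)
  qed
qed

text \<open>
  Only the modulus enters the estimator, and taking it removes the factor \<open>e\<^bsup>i t\<cdot>\<mu>\<^esup>\<close>; along a
  coordinate axis the quadratic form then sees a single diagonal entry of \<open>\<Sigma>\<close>.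
\<close>

lemma cmod_char_sub_Gaussian_stable_axis:
  fixes \<Sigma> :: "real ^ 'p ^ 'p"
  assumes "sub_Gaussian_stable \<mu> \<Sigma> \<alpha> N"
  shows "cmod (CLINT x|N. iexp ((s *\<^sub>R axis k 1) \<bullet> x)) =
    exp (- ((s\<^sup>2 * (\<Sigma> $ k $ k / 2)) powr (\<alpha> / 2)))"
proof -
  have "axis k 1 \<bullet> (\<Sigma> *v axis k 1) = \<Sigma> $ k $ k"
    by (simp add: inner_axis' matrix_vector_mult_basis column_def)
  then have quad: "1/2 * ((s *\<^sub>R axis k 1) \<bullet> (\<Sigma> *v (s *\<^sub>R axis k 1))) = s\<^sup>2 * (\<Sigma> $ k $ k / 2)"
    by (simp add: matrix_vector_mult_scaleR power2_eq_square)
  have "(CLINT x|N. iexp ((s *\<^sub>R axis k 1) \<bullet> x)) =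
      exp (\<i> * complex_of_real ((s *\<^sub>R axis k 1) \<bullet> \<mu>)
           - complex_of_real ((s\<^sup>2 * (\<Sigma> $ k $ k / 2)) powr (\<alpha> / 2)))"
    using assms unfolding sub_Gaussian_stable_def quad[symmetric] by blast
  then show ?thesis
    by (simp only: norm_exp_eq_Re) simp
qed

text \<open>
  The two exponents have quotient \<open>(s\<^sub>1/s\<^sub>2)\<^bsup>\<alpha>\<^esup>\<close>: the common scale \<open>d\<close> is what the ratio of logarithms
  is designed to eliminate.
\<close>

lemma tendsto_log_ratio_estimator:
  fixes s1 s2 d \<alpha> :: real
  assumes pos: "s1 > 0" "s2 > 0" "d > 0" and ne: "s1 \<noteq> s2"
    and r1: "r1 \<longlonglongrightarrow> exp (- ((s1\<^sup>2 * d) powr (\<alpha> / 2)))"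
    and r2: "r2 \<longlonglongrightarrow> exp (- ((s2\<^sup>2 * d) powr (\<alpha> / 2)))"
  shows "(\<lambda>n. 1 / ln \<bar>s1 / s2\<bar> * ln (ln (r1 n) / ln (r2 n))) \<longlonglongrightarrow> \<alpha>"
proof -
  have split_powr: "(s\<^sup>2 * d) powr (\<alpha> / 2) = s powr \<alpha> * d powr (\<alpha> / 2)" if "s > 0" for s
    using that pos by (simp add: powr_mult powr_powr flip: powr_numeral)
  have ln_r1: "(\<lambda>n. ln (r1 n)) \<longlonglongrightarrow> - (s1 powr \<alpha> * d powr (\<alpha> / 2))"
    using tendsto_ln[OF r1] pos by (simp add: split_powr)
  have ln_r2: "(\<lambda>n. ln (r2 n)) \<longlonglongrightarrow> - (s2 powr \<alpha> * d powr (\<alpha> / 2))"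
    using tendsto_ln[OF r2] pos by (simp add: split_powr)
  have "(\<lambda>n. ln (r1 n) / ln (r2 n)) \<longlonglongrightarrow> (s1 / s2) powr \<alpha>"
    using tendsto_divide[OF ln_r1 ln_r2] pos by (simp add: powr_divide)
  then have "(\<lambda>n. ln (ln (r1 n) / ln (r2 n))) \<longlonglongrightarrow> ln ((s1 / s2) powr \<alpha>)"
    by (rule tendsto_ln) (use pos in simp)
  then have "(\<lambda>n. ln (ln (r1 n) / ln (r2 n))) \<longlonglongrightarrow> \<alpha> * ln (s1 / s2)"
    using pos by (simp add: ln_powr)
  then have "(\<lambda>n. 1 / ln \<bar>s1 / s2\<bar> * ln (ln (r1 n) / ln (r2 n)))
      \<longlonglongrightarrow> 1 / ln \<bar>s1 / s2\<bar> * (\<alpha> * ln (s1 / s2))"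
    by (rule tendsto_mult_left)
  moreover have "ln (s1 / s2) \<noteq> 0"
    using pos ne by simp
  ultimately show ?thesis
    using pos by simp
qed

theorem proposition2p2:
  fixes M :: "'a measure"
    and X :: "nat \<Rightarrow> 'a \<Rightarrow> real ^ 'p"
    and N :: "(real ^ 'p) measure"
    and \<mu> :: "real ^ 'p"
    and \<Sigma> :: "real ^ 'p ^ 'p"
    and \<alpha> s1 s2 :: real
  assumes alpha: "0 < \<alpha>" "\<alpha> < 2"
    and Sigma_sym: "transpose \<Sigma> = \<Sigma>"
    and Sigma_psd: "\<And>v. 0 \<le> v \<bullet> (\<Sigma> *v v)"
    and law: "sub_Gaussian_stable \<mu> \<Sigma> \<alpha> N"
    and M: "prob_space M"
    and indep: "prob_space.indep_vars M (\<lambda>_. borel) X UNIV"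
    and ident: "\<And>j. distr M borel (X j) = N"
    and Sigma_diag: "\<And>k. \<Sigma> $ k $ k \<noteq> 0"
    and s: "s1 > 0" "s2 > 0" "s1 \<noteq> s2"
  shows "(\<forall>k. AE \<omega> in M. (\<lambda>n. alpha_hat (\<lambda>j. X j \<omega>) s1 s2 n k) \<longlonglongrightarrow> \<alpha>) \<and>
         (AE \<omega> in M. (\<lambda>n. alpha_hat_mult (\<lambda>j. X j \<omega>) s1 s2 n) \<longlonglongrightarrow> \<alpha>)"
proof -
  interpret prob_space M by (rule M)
  have pos: "\<Sigma> $ k $ k / 2 > 0" for k
  proof -
    have "0 \<le> \<Sigma> $ k $ k"
      using Sigma_psd[of "axis k 1"]
      by (simp add: inner_axis' matrix_vector_mult_basis column_def)
    with Sigma_diag[of k] show ?thesis by simp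
  qed
  have ecf: "AE \<omega> in M. (\<lambda>n. cmod (ecf (\<lambda>j. X j \<omega>) n (s *\<^sub>R axis k 1)))
      \<longlonglongrightarrow> exp (- ((s\<^sup>2 * (\<Sigma> $ k $ k / 2)) powr (\<alpha> / 2)))" for s k
  proof -
    have "AE \<omega> in M. (\<lambda>n. ecf (\<lambda>j. X j \<omega>) n (s *\<^sub>R axis k 1))
        \<longlonglongrightarrow> (CLINT x|N. iexp ((s *\<^sub>R axis k 1) \<bullet> x))"
      unfolding ecf_def
      by (rule strong_law_bounded_complex[OF indep ident, where c = 1]) simp_all
    then show ?thesis
      unfolding cmod_char_sub_Gaussian_stable_axis[OF law, symmetric]
      by eventually_elim (rule tendsto_norm)
  qed
  have single: "AE \<omega> in M. (\<lambda>n. alpha_hat (\<lambda>j. X j \<omega>) s1 s2 n k) \<longlonglongrightarrow> \<alpha>" for k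
    using ecf[of s1 k] ecf[of s2 k]
  proof eventually_elim
    case (elim \<omega>)
    then show ?case
      unfolding alpha_hat_def by (rule tendsto_log_ratio_estimator[OF s(1,2) pos s(3)])
  qed
  then have "AE \<omega> in M. \<forall>k. (\<lambda>n. alpha_hat (\<lambda>j. X j \<omega>) s1 s2 n k) \<longlonglongrightarrow> \<alpha>"
    by (simp add: AE_all_countable)
  then have "AE \<omega> in M. (\<lambda>n. alpha_hat_mult (\<lambda>j. X j \<omega>) s1 s2 n) \<longlonglongrightarrow> \<alpha>"
  proof eventually_elim
    case (elim \<omega>)
    then have "(\<lambda>n. alpha_hat_mult (\<lambda>j. X j \<omega>) s1 s2 n)
        \<longlonglongrightarrow> 1 / real CARD('p) * (\<Sum>k\<in>(UNIV :: 'p set). \<alpha>)"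
      unfolding alpha_hat_mult_def by (intro tendsto_intros) auto
    then show ?case by simp
  qed
  with single show ?thesis by blast
qed

end
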